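(* Let $\mathcal{G}=\{(y_1,a_1),\dots,(y_K,a_K)\}\subseteq\mathcal{Y}\rtimes\mathbb{Z}^n$ and let $\Gamma$ be a $\mathcal{G}$-graph that is symmetric, face-accessible and $\mathbb{Z}^n$-generating. Then there exist $z_1,\dots,z_m\in\mathbb{Z}^n$ such that the union of translations $\widehat\Gamma=\bigcup_{i=1}^m(\Gamma+z_i)$ is an Eulerian graph.
   Context: A $\mathcal{G}$-graph is a finite directed multigraph whose vertex set $V(\Gamma)$ is a finite subset of $\mathbb{Z}^n$ (each vertex incident to an edge), with each edge $e$ (from $s(e)$ to $d(e)$) labeled $\ell(e)\in\{1,\dots,K\}$ and satisfying $d(e)=s(e)+a_{\ell(e)}$. $\Gamma$ is symmetric if at every vertex in-degree equals out-degree; Eulerian if it has an Euler circuit (equivalently symmetric and connected). $\Gamma$ is $\mathbb{Z}^n$-generating if $\{d(e)-s(e): e\in E(\Gamma)\}$ generates $\mathbb{Z}^n$ as a semigroup. Let $C$ be the convex hull of $V(\Gamma)$; a strict face $F$ of $C$ (a nonempty face different from $C$) is accessible if some edge $e$ has $s(e)\in F$ and $d(e)\notin F$; $\Gamma$ is face-accessible if every strict face of $C$ is accessible. The translation $\Gamma+z$ moves all vertices and edges by $z\in\mathbb{Z}^n$ keeping labels; the union $\bigcup_i(\Gamma+z_i)$ is the multigraph whose edge multiset is the sum of the edge multisets of the $\Gamma+z_i$. *)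

theory Defs
  imports "HOL-Analysis.Analysis" "HOL-Library.Multiset"
begin

text \<open>A G-graph with step vectors a 1, ..., a K is encoded as the finite multiset of its
edges; an edge is a pair (source, label), and its destination is source + a label.\<close>

type_synonym 'n ggraph = "((int ^ 'n) \<times> nat) multiset"

definition src :: "(int ^ 'n) \<times> nat \<Rightarrow> int ^ 'n" where
  "src e = fst e"

definition lbl :: "(int ^ 'n) \<times> nat \<Rightarrow> nat" where
  "lbl e = snd e"

definition dst :: "(nat \<Rightarrow> int ^ 'n) \<Rightarrow> (int ^ 'n) \<times> nat \<Rightarrow> int ^ 'n" where
  "dst a e = fst e + a (snd e)"

definition is_ggraph :: "nat \<Rightarrow> (nat \<Rightarrow> int ^ 'n) \<Rightarrow> 'n ggraph \<Rightarrow> bool" where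
  "is_ggraph K a E \<longleftrightarrow> (\<forall>e \<in># E. lbl e \<in> {1..K})"

definition vertices :: "(nat \<Rightarrow> int ^ 'n) \<Rightarrow> 'n ggraph \<Rightarrow> (int ^ 'n) set" where
  "vertices a E = src ` set_mset E \<union> dst a ` set_mset E"

definition symmetric_gg :: "(nat \<Rightarrow> int ^ 'n) \<Rightarrow> 'n ggraph \<Rightarrow> bool" where
  "symmetric_gg a E \<longleftrightarrow>
     (\<forall>v. size (filter_mset (\<lambda>e. dst a e = v) E) = size (filter_mset (\<lambda>e. src e = v) E))"

definition eulerian_gg :: "(nat \<Rightarrow> int ^ 'n) \<Rightarrow> 'n ggraph \<Rightarrow> bool" where
  "eulerian_gg a E \<longleftrightarrow>
     (\<exists>es. es \<noteq> [] \<and> mset es = E \<and>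
        (\<forall>i. Suc i < length es \<longrightarrow> dst a (es ! i) = src (es ! Suc i)) \<and>
        dst a (last es) = src (hd es))"

inductive_set semigroup_gen :: "'a::plus set \<Rightarrow> 'a set" for S where
  base: "x \<in> S \<Longrightarrow> x \<in> semigroup_gen S"
| add: "x \<in> semigroup_gen S \<Longrightarrow> y \<in> semigroup_gen S \<Longrightarrow> x + y \<in> semigroup_gen S"

definition Zn_generating :: "(nat \<Rightarrow> int ^ 'n) \<Rightarrow> 'n ggraph \<Rightarrow> bool" where
  "Zn_generating a E \<longleftrightarrow>
     semigroup_gen ((\<lambda>e. dst a e - src e) ` set_mset E) = UNIV"

definition to_real :: "int ^ 'n \<Rightarrow> real ^ 'n" where
  "to_real v = (\<chi> i. real_of_int (v $ i))"

definition face_accessible :: "(nat \<Rightarrow> int ^ 'n) \<Rightarrow> 'n ggraph \<Rightarrow> bool" where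
  "face_accessible a E \<longleftrightarrow>
     (let C = convex hull (to_real ` vertices a E) in
      \<forall>F. F face_of C \<and> F \<noteq> {} \<and> F \<noteq> C \<longrightarrow>
          (\<exists>e \<in># E. to_real (src e) \<in> F \<and> to_real (dst a e) \<notin> F))"

definition translate_gg :: "'n ggraph \<Rightarrow> int ^ 'n \<Rightarrow> 'n ggraph" where
  "translate_gg E z = image_mset (\<lambda>(s, l). (s + z, l)) E"

definition union_translates :: "'n ggraph \<Rightarrow> (int ^ 'n) list \<Rightarrow> 'n ggraph" where
  "union_translates E zs = sum_list (map (translate_gg E) zs)"

end

theory Submission
  imports Defs
begin

text \<open>Let \<open>C\<close> be the convex hull of the vertices and take all translates of \<open>\<Gamma>\<close> by lattice points of
  \<open>N C\<close> for a large \<open>N\<close>; the vertices of the union lie in \<open>(N + 1) C\<close>. A vertex close to exactly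
  the facets through a face \<open>F\<close> of \<open>(N + 1) C\<close> admits every edge of \<open>\<Gamma>\<close> that starts on the
  corresponding face of \<open>C\<close>, so face-accessibility lets one move away from \<open>F\<close> and, repeating this,
  reach the deep interior. There all edges are available, and since their steps generate
  the lattice as a semigroup, any two deep points are joined by a path. A symmetric graph can also be
  traversed backwards, so the union is connected and hence Eulerian.\<close>

section \<open>Euler circuits of directed multigraphs\<close>

text \<open>Edges and vertices are abstract, with source and target maps \<open>s\<close> and
  \<open>t\<close>, so that the graph theory is independent of the lattice; later
  \<open>s = src\<close> and \<open>t = dst a\<close>.\<close>

primrec walk :: "('e \<Rightarrow> 'v) \<Rightarrow> ('e \<Rightarrow> 'v) \<Rightarrow> 'v \<Rightarrow> 'e list \<Rightarrow> 'v \<Rightarrow> bool" where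
  "walk s t u [] v \<longleftrightarrow> u = v"
| "walk s t u (e # es) v \<longleftrightarrow> s e = u \<and> walk s t (t e) es v"

definition balanced :: "('e \<Rightarrow> 'v) \<Rightarrow> ('e \<Rightarrow> 'v) \<Rightarrow> 'e multiset \<Rightarrow> bool" where
  "balanced s t E \<longleftrightarrow>
     (\<forall>v. size (filter_mset (\<lambda>e. t e = v) E) = size (filter_mset (\<lambda>e. s e = v) E))"

text \<open>Forgetting multiplicities turns connectivity into a statement about a reflexive
  transitive closure.\<close>

definition edge_rel :: "('e \<Rightarrow> 'v) \<Rightarrow> ('e \<Rightarrow> 'v) \<Rightarrow> 'e multiset \<Rightarrow> ('v \<times> 'v) set" where
  "edge_rel s t E = (\<lambda>e. (s e, t e)) ` set_mset E"

lemma walk_append: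
  "walk s t u (es @ fs) w \<longleftrightarrow> (\<exists>v. walk s t u es v \<and> walk s t v fs w)"
  by (induction es arbitrary: u) auto

text \<open>A walk leaves each vertex as often as it enters it, up to its two ends. The end
  corrections stand on both sides to avoid subtraction of naturals.\<close>

lemma walk_degrees:
  "walk s t u es v \<Longrightarrow>
    size (filter_mset (\<lambda>e. t e = x) (mset es)) + (if x = u then 1 else 0) =
    size (filter_mset (\<lambda>e. s e = x) (mset es)) + (if x = v then 1 else 0)"
proof (induction es arbitrary: u)
  case (Cons e es)
  from Cons.prems have "s e = u" "walk s t (t e) es v" by auto
  with Cons.IH[OF this(2)] show ?case by (auto split: if_splits)
qed auto

lemma walk_reach:
  assumes "walk s t u es v" "set es \<subseteq> set_mset E"
  shows "(u, v) \<in> (edge_rel s t E)\<^sup>*"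
  using assms
proof (induction es arbitrary: u)
  case (Cons e es)
  then have "(u, t e) \<in> edge_rel s t E" by (auto simp: edge_rel_def)
  moreover from Cons have "(t e, v) \<in> (edge_rel s t E)\<^sup>*" by auto
  ultimately show ?case by (rule converse_rtrancl_into_rtrancl)
qed auto

lemma walk_consecutive:
  "walk s t u es v \<Longrightarrow> Suc i < length es \<Longrightarrow> t (es ! i) = s (es ! Suc i)"
proof (induction es arbitrary: u i)
  case (Cons e es)
  then show ?case
    by (cases i; cases es) auto
qed auto

lemma walk_ends:
  "walk s t u es v \<Longrightarrow> es \<noteq> [] \<Longrightarrow> s (hd es) = u \<and> t (last es) = v"
  by (induction es arbitrary: u) auto

text \<open>The target of an edge is the source of the next one; for the last edge, closedness makes
  the first edge its successor.\<close>

lemma closed_walk_targets: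
  assumes "walk s t u es u"
  shows "t ` set es \<subseteq> s ` set es"
proof
  fix x assume "x \<in> t ` set es"
  then obtain i where i: "i < length es" "x = t (es ! i)" by (auto simp: in_set_conv_nth)
  show "x \<in> s ` set es"
  proof (cases "Suc i < length es")
    case True
    with walk_consecutive[OF assms True] i show ?thesis by auto
  next
    case False
    with i have ne: "es \<noteq> []" and "i = length es - 1" by auto
    then have "x = t (last es)" using i by (simp add: last_conv_nth)
    then have "x = s (hd es)" using walk_ends[OF assms ne] by simp
    with ne show ?thesis by auto
  qed
qed

lemma balanced_add:
  "balanced s t (A + B) \<Longrightarrow> balanced s t A \<Longrightarrow> balanced s t B"
  unfolding balanced_def by auto

lemma closed_walk_balanced: "walk s t u es u \<Longrightarrow> balanced s t (mset es)"
  unfolding balanced_def using walk_degrees[of s t u es u] by (metis add_right_cancel)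

lemma edge_on_closed_walk:
  assumes bal: "balanced s t E" and e: "e \<in># E"
  shows "\<exists>es. walk s t (t e) es (s e) \<and> mset (e # es) \<subseteq># E"
proof -
  let ?P = "\<lambda>es. (\<exists>v. walk s t (t e) es v) \<and> mset (e # es) \<subseteq># E"
  have "?P []" using e by auto
  moreover have "\<forall>es. ?P es \<longrightarrow> length es < Suc (size E)"
    by (auto dest!: size_mset_mono)
  ultimately obtain es where es: "?P es" and mx: "\<forall>es'. ?P es' \<longrightarrow> length es' \<le> length es"
    using ex_has_greatest_nat[of ?P "[]" length "Suc (size E)"] by (meson less_imp_le)
  then obtain v where v: "walk s t (t e) es v" by auto
  have "v = s e"
  proof (rule ccontr)
    assume ne: "v \<noteq> s e"
    from v have w: "walk s t (s e) (e # es) v" by simp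
    obtain X where X: "E = mset (e # es) + X" using es by (auto simp only: subset_mset.le_iff_add)
    have "size (filter_mset (\<lambda>e. t e = v) E) = size (filter_mset (\<lambda>e. s e = v) E)"
      using bal by (simp add: balanced_def)
    with walk_degrees[OF w, of v] ne have "size (filter_mset (\<lambda>e. s e = v) X) > 0"
      unfolding X by (auto split: if_splits)
    then have "filter_mset (\<lambda>e. s e = v) X \<noteq> {#}" by (simp only: nonempty_has_size)
    then obtain f where "f \<in># filter_mset (\<lambda>e. s e = v) X" by (rule multiset_nonemptyE)
    then have f: "f \<in># X" "s f = v" by simp_all
    have "walk s t (t e) (es @ [f]) (t f)" using v f by (auto simp: walk_append)
    moreover have "mset (e # es @ [f]) \<subseteq># E" using f unfolding X by simp
    ultimately have "?P (es @ [f])" by auto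
    with mx show False by fastforce
  qed
  with v es show ?thesis by auto
qed

text \<open>Each edge lies on a closed walk, and the rest of that walk leads back from its target to
  its source.\<close>

lemma balanced_reach_sym:
  assumes bal: "balanced s t E" and "(u, v) \<in> (edge_rel s t E)\<^sup>*"
  shows "(v, u) \<in> (edge_rel s t E)\<^sup>*"
  using assms(2)
proof (induction rule: rtrancl_induct)
  case (step y z)
  then obtain e where e: "e \<in># E" "y = s e" "z = t e" by (auto simp: edge_rel_def)
  with edge_on_closed_walk[OF bal e(1)] obtain es
    where es: "walk s t z es y" "mset (e # es) \<subseteq># E" by auto
  then have "set es \<subseteq> set_mset E" using set_mset_mono[OF es(2)] by auto
  from walk_reach[OF es(1) this] step.IH show ?case by auto
qed auto

text \<open>Hierholzer's argument: a longest closed trail leaves a balanced remainder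
  \<open>X\<close>. If \<open>X\<close> were nonempty, connectivity would give an edge of
  \<open>X\<close> at a vertex of the trail, and a closed walk through that edge could be spliced
  in.\<close>

theorem euler_circuit:
  assumes bal: "balanced s t E" and ne: "E \<noteq> {#}"
    and conn: "\<And>e f. e \<in># E \<Longrightarrow> f \<in># E \<Longrightarrow> (s e, s f) \<in> (edge_rel s t E)\<^sup>*"
  shows "\<exists>es u. es \<noteq> [] \<and> mset es = E \<and> walk s t u es u"
proof -
  let ?P = "\<lambda>es. es \<noteq> [] \<and> (\<exists>u. walk s t u es u) \<and> mset es \<subseteq># E"
  obtain e0 where e0: "e0 \<in># E" using ne by auto
  with edge_on_closed_walk[OF bal this] obtain es0
    where "walk s t (t e0) es0 (s e0)" "mset (e0 # es0) \<subseteq># E" by auto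
  then have "?P (e0 # es0)" by auto
  moreover have "\<forall>es. ?P es \<longrightarrow> length es < Suc (size E)"
    by (auto dest!: size_mset_mono)
  ultimately obtain es where es: "?P es" and mx: "\<forall>es'. ?P es' \<longrightarrow> length es' \<le> length es"
    using ex_has_greatest_nat[of ?P "e0 # es0" length "Suc (size E)"] by (meson less_imp_le)
  then obtain u where u: "walk s t u es u" by auto
  obtain X where X: "E = mset es + X" using es by (auto simp only: subset_mset.le_iff_add)
  have balX: "balanced s t X" using bal closed_walk_balanced[OF u] balanced_add unfolding X by blast
  have "X = {#}"
  proof (rule ccontr)
    assume "X \<noteq> {#}"
    then obtain f where f: "f \<in># X" by auto
    have "\<exists>g \<in># X. s g \<in> s ` set es"
    proof (rule ccontr)
      assume no: "\<not> ?thesis"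
      \<comment> \<open>Without such an edge, every edge of \<open>E\<close> starting at a vertex of
        the circuit lies on the circuit, so its vertex set is closed under reachability.\<close>
      have "y \<in> s ` set es" if "(x, y) \<in> (edge_rel s t E)\<^sup>*" "x \<in> s ` set es" for x y
        using that
      proof (induction rule: rtrancl_induct)
        case (step y z)
        then obtain g where g: "g \<in># E" "y = s g" "z = t g" by (auto simp: edge_rel_def)
        with no step have "g \<in> set es" unfolding X by auto
        with closed_walk_targets[OF u] g show ?case by auto
      qed
      moreover have "(s (hd es), s f) \<in> (edge_rel s t E)\<^sup>*"
        by (rule conn) (use es f in \<open>auto simp: X\<close>)
      moreover have "s (hd es) \<in> s ` set es" using es by auto
      ultimately have "s f \<in> s ` set es" by blast
      with no f show False by auto
    qed
    then obtain g k where g: "g \<in># X" and k: "k \<in> set es" "s k = s g" by auto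
    from edge_on_closed_walk[OF balX g] obtain cs
      where cs: "walk s t (t g) cs (s g)" "mset (g # cs) \<subseteq># X" by auto
    from k obtain p q where pq: "es = p @ k # q" by (meson split_list)
    with u k have "walk s t u p (s g)" "walk s t (s g) (k # q) u" by (auto simp: walk_append)
    \<comment> \<open>Rotate the circuit so that it starts at \<open>s k = s g\<close>, then append
      the detour \<open>g # cs\<close>.\<close>
    with cs have "walk s t (s g) ((k # q) @ p @ (g # cs)) (s g)"
      unfolding walk_append by auto
    moreover have "mset ((k # q) @ p @ (g # cs)) = mset es + mset (g # cs)"
      by (simp add: pq)
    then have "mset ((k # q) @ p @ (g # cs)) \<subseteq># E"
      using subset_mset.add_left_mono[OF cs(2), of "mset es"] by (simp only: X)
    ultimately have "?P ((k # q) @ p @ (g # cs))" by blast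
    with mx have "length ((k # q) @ p @ (g # cs)) \<le> length es" by blast
    then show False by (simp add: pq)
  qed
  with X es u show ?thesis by auto
qed

section \<open>Lattice points of dilated polyhedra\<close>

text \<open>A pair \<open>h = (u, b)\<close> stands for the half-space of points with inner product
  with \<open>u\<close> at most \<open>b\<close>. For \<open>r > 0\<close>, nonnegative slack for
  every \<open>h\<close> means membership in the \<open>r\<close>-fold dilate of the polyhedron;
  normals are not normalised, so slack is only proportional to distance.\<close>

definition slack :: "(real ^ 'n) \<times> real \<Rightarrow> real \<Rightarrow> int ^ 'n \<Rightarrow> real" where
  "slack h r x = r * snd h - fst h \<bullet> to_real x"

lemma to_real_add: "to_real (x + y) = to_real x + to_real y"
  by (simp add: to_real_def vec_eq_iff)

lemma to_real_diff: "to_real (x - y) = to_real x - to_real y"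
  by (simp add: to_real_def vec_eq_iff)

text \<open>Additivity in dilation factor and point together: a vertex in \<open>C\<close>
  translated by a point of \<open>N C\<close> lies in \<open>(N + 1) C\<close>.\<close>

lemma slack_add: "slack h (r + r') (x + y) = slack h r x + slack h r' y"
  by (simp add: slack_def to_real_add algebra_simps)

lemma slack_diff: "slack h (r - r') (x - y) = slack h r x - slack h r' y"
  by (simp add: slack_def to_real_diff algebra_simps)

lemma finite_bounded_int_vec: "finite {x :: int ^ 'n. \<forall>i. \<bar>x $ i\<bar> \<le> B}"
proof (rule finite_imageD)
  show "finite (vec_nth ` {x :: int ^ 'n. \<forall>i. \<bar>x $ i\<bar> \<le> B})"
    by (rule finite_subset[OF _ finite_PiE[of UNIV "\<lambda>_. {-B..B}"]]) (auto simp: abs_le_iff minus_le_iff)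
  show "inj_on vec_nth {x :: int ^ 'n. \<forall>i. \<bar>x $ i\<bar> \<le> B}"
    by (auto simp: inj_on_def vec_nth_inject)
qed

section \<open>Unions of translates\<close>

lemma set_mset_union_translates:
  "set_mset (union_translates E zs) = (\<Union>z\<in>set zs. (\<lambda>(s, l). (s + z, l)) ` set_mset E)"
  by (induction zs) (auto simp: union_translates_def translate_gg_def)

lemma balanced_translate:
  assumes "balanced src (dst a) E"
  shows "balanced src (dst a) (translate_gg E z)"
  unfolding balanced_def
proof
  fix v
  have "size (filter_mset (\<lambda>e. dst a e = v) (translate_gg E z)) =
      size (filter_mset (\<lambda>e. dst a e = v - z) E)"
    by (auto simp: translate_gg_def filter_mset_image_mset dst_def algebra_simps case_prod_beta
        intro!: arg_cong[of _ _ size] filter_mset_cong)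
  moreover have "size (filter_mset (\<lambda>e. src e = v) (translate_gg E z)) =
      size (filter_mset (\<lambda>e. src e = v - z) E)"
    by (auto simp: translate_gg_def filter_mset_image_mset src_def algebra_simps case_prod_beta
        intro!: arg_cong[of _ _ size] filter_mset_cong)
  ultimately show "size (filter_mset (\<lambda>e. dst a e = v) (translate_gg E z)) =
      size (filter_mset (\<lambda>e. src e = v) (translate_gg E z))"
    using assms by (simp add: balanced_def)
qed

lemma balanced_union_translates:
  assumes "balanced src (dst a) E"
  shows "balanced src (dst a) (union_translates E zs)"
proof (induction zs)
  case Nil
  show ?case by (simp add: union_translates_def balanced_def)
next
  case (Cons z zs)
  with balanced_translate[OF assms, of z] show ?case
    by (simp add: union_translates_def balanced_def)
qed

section \<open>Moving inside a dilated polyhedron\<close>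

locale slack_system =
  fixes a :: "nat \<Rightarrow> int ^ 'n" and \<Gamma> :: "'n ggraph" and H :: "((real ^ 'n) \<times> real) set"
  assumes finite_H: "finite H"
    and slack_nonneg: "\<lbrakk>h \<in> H; v \<in> vertices a \<Gamma>\<rbrakk> \<Longrightarrow> 0 \<le> slack h 1 v"
    and generating: "Zn_generating a \<Gamma>"
begin

text \<open>The face attached to \<open>J\<close> is where all its constraints are tight. The edge
  starts on this face and leaves it, expressed through slacks alone.\<close>

definition accessible :: "((real ^ 'n) \<times> real) set \<Rightarrow> bool" where
  "accessible J \<longleftrightarrow> (\<exists>e \<in># \<Gamma>. (\<forall>h\<in>J. slack h 1 (src e) = 0) \<and> (\<exists>h\<in>J. 0 < slack h 1 (dst a e)))"

definition inside :: "nat \<Rightarrow> int ^ 'n \<Rightarrow> bool" where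
  "inside N w \<longleftrightarrow> (\<forall>h\<in>H. 0 \<le> slack h (real N + 1) w)"

definition deep :: "real \<Rightarrow> nat \<Rightarrow> int ^ 'n \<Rightarrow> bool" where
  "deep D N w \<longleftrightarrow> (\<forall>h\<in>H. D \<le> slack h (real N + 1) w)"

text \<open>The translation that places \<open>e\<close> at \<open>w\<close> is
  \<open>w - src e\<close>, which must lie in the \<open>N\<close>-fold dilate. This is the edge
  relation of the union, described before any list of translates is chosen.\<close>

definition step_rel :: "nat \<Rightarrow> ((int ^ 'n) \<times> (int ^ 'n)) set" where
  "step_rel N = {(w, w + (dst a e - src e)) | w e. e \<in># \<Gamma> \<and> (\<forall>h\<in>H. 0 \<le> slack h (real N) (w - src e))}"

text \<open>Used in contrapositive form: if a point of the dilate has slack below \<open>R\<close>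
  for all of a nonempty \<open>J\<close>, then \<open>J\<close> is accessible and there is an edge
  to escape along.\<close>

definition large_for :: "real \<Rightarrow> nat \<Rightarrow> bool" where
  "large_for R N \<longleftrightarrow> (\<forall>J\<subseteq>H. J \<noteq> {} \<longrightarrow> \<not> accessible J \<longrightarrow>
     (\<forall>w. inside N w \<longrightarrow> (\<exists>h\<in>J. R \<le> slack h (real N + 1) w)))"

lemma finite_vertices: "finite (vertices a \<Gamma>)"
  by (simp add: vertices_def)

lemma edge_vertices:
  "e \<in># \<Gamma> \<Longrightarrow> src e \<in> vertices a \<Gamma>" "e \<in># \<Gamma> \<Longrightarrow> dst a e \<in> vertices a \<Gamma>"
  by (auto simp: vertices_def)

lemma slack_bound:
  obtains D where "D > 0" "\<And>h v. h \<in> H \<Longrightarrow> v \<in> vertices a \<Gamma> \<Longrightarrow> slack h 1 v \<le> D"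
proof -
  let ?X = "(\<lambda>(h, v). slack h 1 v) ` (H \<times> vertices a \<Gamma>)"
  have "finite ?X" using finite_H finite_vertices by simp
  then obtain M where M: "\<And>x. x \<in> ?X \<Longrightarrow> x \<le> M"
    using bdd_above_finite[of ?X] unfolding bdd_above_def by blast
  show thesis
  proof (rule that[of "max M 1"])
    show "slack h 1 v \<le> max M 1" if "h \<in> H" "v \<in> vertices a \<Gamma>" for h v
    proof -
      have "(h, v) \<in> H \<times> vertices a \<Gamma>" using that by simp
      from imageI[OF this, of "\<lambda>(h, v). slack h 1 v"] have "slack h 1 v \<le> M" by (intro M) simp
      then show ?thesis by simp
    qed
  qed simp
qed

lemma slack_gap:
  obtains \<delta> where "\<delta> > 0"
    "\<And>h v. h \<in> H \<Longrightarrow> v \<in> vertices a \<Gamma> \<Longrightarrow> 0 < slack h 1 v \<Longrightarrow> \<delta> \<le> slack h 1 v"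
proof -
  \<comment> \<open>The extra element \<open>1\<close> keeps the minimum meaningful when no vertex
    has positive slack.\<close>
  let ?X = "insert 1 ({x. 0 < x} \<inter> (\<lambda>(h, v). slack h 1 v) ` (H \<times> vertices a \<Gamma>))"
  have fin: "finite ?X" using finite_H finite_vertices by simp
  have "Min ?X \<in> ?X" using fin by (intro Min_in) auto
  then have "Min ?X > 0" by auto
  moreover have "Min ?X \<le> slack h 1 v"
    if "h \<in> H" "v \<in> vertices a \<Gamma>" "0 < slack h 1 v" for h v
  proof (rule Min_le[OF fin])
    have "(h, v) \<in> H \<times> vertices a \<Gamma>" using that by simp
    from imageI[OF this, of "\<lambda>(h, v). slack h 1 v"] that show "slack h 1 v \<in> ?X" by simp
  qed
  ultimately show thesis using that by blast
qed

lemma slack_move: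
  "slack h r (w + (dst a e - src e)) = slack h r w + slack h 1 (dst a e) - slack h 1 (src e)"
  by (simp add: slack_def to_real_add to_real_diff algebra_simps)

text \<open>An edge is available at \<open>w\<close> once \<open>w\<close> has at least as much
  slack in the \<open>(N + 1)\<close>-fold dilate as the edge's source has in the original
  polyhedron.\<close>

lemma step_relI:
  assumes "e \<in># \<Gamma>" "\<And>h. h \<in> H \<Longrightarrow> slack h 1 (src e) \<le> slack h (real N + 1) w"
  shows "(w, w + (dst a e - src e)) \<in> step_rel N"
proof -
  have "0 \<le> slack h (real N) (w - src e)" if "h \<in> H" for h
    using assms(2)[OF that] slack_diff[of h "real N + 1" 1 w "src e"] by simp
  with assms(1) show ?thesis unfolding step_rel_def by blast
qed

text \<open>Induction on the number of half-spaces whose boundary is close to \<open>w\<close>. These boundaries meet in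
  an accessible face; repeatedly using an edge that leaves this face moves \<open>w\<close> away from one of
  them within a bounded number of steps, so that the other boundaries remain far away.\<close>

lemma reaches_deep_aux:
  assumes D: "D > 0" "\<And>h v. h \<in> H \<Longrightarrow> v \<in> vertices a \<Gamma> \<Longrightarrow> slack h 1 v \<le> D" and "D \<le> D0"
  shows "\<exists>R\<ge>D0. \<forall>N w. large_for R N \<longrightarrow> inside N w \<longrightarrow>
      card {h\<in>H. slack h (real N + 1) w < R} \<le> j \<longrightarrow>
      (\<exists>w'. (w, w') \<in> (step_rel N)\<^sup>* \<and> deep D0 N w')"
proof (induction j)
  case 0
  show ?case
  proof (intro exI[of _ D0] conjI allI impI)
    fix N w assume "card {h\<in>H. slack h (real N + 1) w < D0} \<le> 0"
    then have "{h\<in>H. slack h (real N + 1) w < D0} = {}" using finite_H by simp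
    then have "deep D0 N w" by (force simp: deep_def)
    then show "\<exists>w'. (w, w') \<in> (step_rel N)\<^sup>* \<and> deep D0 N w'" by blast
  qed simp
next
  case (Suc j)
  then obtain R0 where R0: "R0 \<ge> D0" and IH0: "\<And>N w. \<lbrakk>large_for R0 N; inside N w;
      card {h\<in>H. slack h (real N + 1) w < R0} \<le> j\<rbrakk> \<Longrightarrow>
      \<exists>w'. (w, w') \<in> (step_rel N)\<^sup>* \<and> deep D0 N w'" by blast
  have R0_D: "R0 \<ge> D" "R0 > 0" using R0 D \<open>D \<le> D0\<close> by auto
  obtain \<delta> where \<delta>: "\<delta> > 0"
    "\<And>h v. h \<in> H \<Longrightarrow> v \<in> vertices a \<Gamma> \<Longrightarrow> 0 < slack h 1 v \<Longrightarrow> \<delta> \<le> slack h 1 v"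
    using slack_gap by blast
  \<comment> \<open>Here \<open>k\<close> is a budget of steps. Each step costs a constraint outside
    \<open>J\<close> at most \<open>D\<close> and raises the total slack over \<open>J\<close> by at
    least \<open>\<delta>\<close>. At \<open>k = 0\<close> the total is at least
    \<open>card H * R0\<close>, so some constraint in \<open>J\<close> has slack at least
    \<open>R0\<close> and the induction hypothesis for \<open>j\<close> applies. Using
    \<open>card H\<close> keeps the budget independent of \<open>J\<close>.\<close>
  have leave: "\<exists>w'. (w, w') \<in> (step_rel N)\<^sup>* \<and> deep D0 N w'"
    if large: "large_for R0 N" and J: "J \<subseteq> H" "J \<noteq> {}" "card J \<le> Suc j" and "inside N w"
      and "\<forall>h\<in>H - J. R0 + real k * D \<le> slack h (real N + 1) w"
      and "real (card H) * R0 - real k * \<delta> \<le> (\<Sum>h\<in>J. slack h (real N + 1) w)" for N J k w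
    using that(5-)
  proof (induction k arbitrary: w)
    case 0
    have finJ: "finite J" using J finite_H finite_subset by blast
    have "\<exists>h\<in>J. R0 \<le> slack h (real N + 1) w"
    proof (rule ccontr)
      assume "\<not> ?thesis"
      then have "(\<Sum>h\<in>J. slack h (real N + 1) w) < of_nat (card J) * R0"
        using finJ J by (intro sum_bounded_above_strict) (auto simp: card_gt_0_iff not_le)
      also have "\<dots> \<le> of_nat (card H) * R0"
        using R0_D card_mono[OF finite_H J(1)] by (intro mult_right_mono) auto
      finally show False using 0 by simp
    qed
    then obtain h where h: "h \<in> J" "R0 \<le> slack h (real N + 1) w" by blast
    have "{h\<in>H. slack h (real N + 1) w < R0} \<subseteq> J - {h}" using h 0 by force
    then have "card {h\<in>H. slack h (real N + 1) w < R0} \<le> card (J - {h})"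
      using finJ by (intro card_mono) auto
    also have "\<dots> \<le> j" using h finJ J by simp
    finally show ?case by (rule IH0[OF large \<open>inside N w\<close>])
  next
    case (Suc k)
    have finJ: "finite J" using J finite_H finite_subset by blast
    have far: "R0 + (real k + 1) * D \<le> slack h (real N + 1) w" if "h \<in> H - J" for h
      using Suc.prems(2) that by (simp add: add.commute)
    show ?case
    proof (cases "\<exists>h\<in>J. R0 \<le> slack h (real N + 1) w")
      case True
      then obtain h where h: "h \<in> J" "R0 \<le> slack h (real N + 1) w" by blast
      have "R0 \<le> slack h (real N + 1) w" if "h \<in> H - J" for h
        using far[OF that] D(1) by (smt (verit) mult_nonneg_nonneg of_nat_0_le_iff)
      with h have "{h\<in>H. slack h (real N + 1) w < R0} \<subseteq> J - {h}" by force
      then have "card {h\<in>H. slack h (real N + 1) w < R0} \<le> card (J - {h})"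
        using finJ by (intro card_mono) auto
      also have "\<dots> \<le> j" using h finJ J by simp
      finally show ?thesis by (rule IH0[OF large \<open>inside N w\<close>])
    next
      case False
      with large J Suc.prems(1) have "accessible J" unfolding large_for_def by blast
      then obtain e h where e: "e \<in># \<Gamma>" "\<And>h. h \<in> J \<Longrightarrow> slack h 1 (src e) = 0"
        and h: "h \<in> J" "0 < slack h 1 (dst a e)" unfolding accessible_def by blast
      \<comment> \<open>The source of \<open>e\<close> is tight for all of \<open>J\<close>, so no
        slack in \<open>J\<close> decreases, and the one for \<open>h\<close> grows.\<close>
      let ?w = "w + (dst a e - src e)"
      have ins: "0 \<le> slack h (real N + 1) w" if "h \<in> H" for h
        using Suc.prems(1) that by (simp add: inside_def)
      have dst0: "0 \<le> slack h 1 (dst a e)" if "h \<in> H" for h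
        using slack_nonneg[OF that edge_vertices(2)[OF e(1)]] .
      have srcD: "slack h 1 (src e) \<le> D" if "h \<in> H" for h
        using D(2)[OF that edge_vertices(1)[OF e(1)]] .
      have kD: "0 \<le> real k * D" using D(1) by simp
      have far': "R0 + real k * D \<le> slack h (real N + 1) ?w" if "h \<in> H - J" for h
        using far[OF that] dst0[of h] srcD[of h] that
        unfolding slack_move by (simp add: algebra_simps)
      have nearJ: "slack h (real N + 1) ?w = slack h (real N + 1) w + slack h 1 (dst a e)"
        if "h \<in> J" for h using e(2)[OF that] by (simp add: slack_move)
      have "(w, ?w) \<in> step_rel N"
      proof (rule step_relI[OF e(1)])
        fix h assume hH: "h \<in> H"
        show "slack h 1 (src e) \<le> slack h (real N + 1) w"
        proof (cases "h \<in> J")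
          case True
          then show ?thesis using e(2) ins[OF hH] by simp
        next
          case False
          have "D \<le> R0 + (real k + 1) * D" using R0_D kD D(1) by (simp add: algebra_simps)
          with False hH far[of h] srcD[OF hH] show ?thesis by auto
        qed
      qed
      moreover have "\<exists>w'. (?w, w') \<in> (step_rel N)\<^sup>* \<and> deep D0 N w'"
      proof (rule Suc.IH)
        show "inside N ?w" unfolding inside_def
        proof
          fix h assume hH: "h \<in> H"
          show "0 \<le> slack h (real N + 1) ?w"
          proof (cases "h \<in> J")
            case True
            then show ?thesis using nearJ ins[OF hH] dst0[OF hH] by simp
          next
            case False
            with far'[of h] hH kD R0_D show ?thesis by auto
          qed
        qed
        show "\<forall>h\<in>H - J. R0 + real k * D \<le> slack h (real N + 1) ?w" using far' by blast
        have "\<delta> \<le> slack h 1 (dst a e)"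
          using \<delta>(2)[OF _ edge_vertices(2)[OF e(1)] h(2)] h(1) J by blast
        also have "\<dots> \<le> (\<Sum>h\<in>J. slack h 1 (dst a e))"
          using h(1) finJ dst0 J by (intro member_le_sum) auto
        finally have "\<delta> \<le> (\<Sum>h\<in>J. slack h 1 (dst a e))" .
        moreover have "(\<Sum>h\<in>J. slack h (real N + 1) ?w) =
            (\<Sum>h\<in>J. slack h (real N + 1) w) + (\<Sum>h\<in>J. slack h 1 (dst a e))"
          by (simp add: nearJ sum.distrib)
        ultimately show "real (card H) * R0 - real k * \<delta> \<le> (\<Sum>h\<in>J. slack h (real N + 1) ?w)"
          using Suc.prems(3) by (simp add: algebra_simps)
      qed
      ultimately show ?thesis by (meson converse_rtrancl_into_rtrancl)
    qed
  qed
  \<comment> \<open>\<open>S\<close> steps suffice from any start: the required lower bound on the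
    total slack is then nonpositive. The threshold \<open>R\<close> below reserves
    \<open>S * D\<close> for losses outside \<open>J\<close>.\<close>
  obtain S where "real (card H) * R0 / \<delta> \<le> real S" using real_arch_simple by blast
  then have S: "real (card H) * R0 - real S * \<delta> \<le> 0" using \<delta>(1) by (simp add: field_simps)
  define R where "R = R0 + real S * D"
  have "R0 \<le> R" using D(1) by (simp add: R_def)
  show ?case
  proof (intro exI[of _ R] conjI allI impI)
    show "D0 \<le> R" using R0 \<open>R0 \<le> R\<close> by simp
    fix N w
    assume large: "large_for R N" and ins: "inside N w"
      and crd: "card {h\<in>H. slack h (real N + 1) w < R} \<le> Suc j"
    let ?J = "{h\<in>H. slack h (real N + 1) w < R}"
    have large0: "large_for R0 N" using large \<open>R0 \<le> R\<close> unfolding large_for_def by (meson order_trans)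
    show "\<exists>w'. (w, w') \<in> (step_rel N)\<^sup>* \<and> deep D0 N w'"
    proof (cases "?J = {}")
      case True
      then have "{h\<in>H. slack h (real N + 1) w < R0} = {}" using \<open>R0 \<le> R\<close> by force
      then show ?thesis by (intro IH0[OF large0 ins]) (simp only: card.empty)
    next
      case False
      show ?thesis
      proof (rule leave[OF large0 _ False crd ins, where k = S])
        show "\<forall>h\<in>H - ?J. R0 + real S * D \<le> slack h (real N + 1) w" by (auto simp: R_def)
        have "0 \<le> (\<Sum>h\<in>?J. slack h (real N + 1) w)"
          using ins by (intro sum_nonneg) (auto simp: inside_def)
        with S show "real (card H) * R0 - real S * \<delta> \<le> (\<Sum>h\<in>?J. slack h (real N + 1) w)" by linarith
      qed blast
    qed
  qed
qed

lemma reaches_deep: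
  obtains R where "\<And>N w. large_for R N \<Longrightarrow> inside N w \<Longrightarrow>
    \<exists>w'. (w, w') \<in> (step_rel N)\<^sup>* \<and> deep D0 N w'"
proof -
  obtain D where D: "D > 0" "\<And>h v. h \<in> H \<Longrightarrow> v \<in> vertices a \<Gamma> \<Longrightarrow> slack h 1 v \<le> D"
    using slack_bound by blast
  \<comment> \<open>With \<open>j = card H\<close> the cardinality bound is automatic; the maximum
    meets the requirement that the target depth be at least \<open>D\<close>.\<close>
  obtain R where R: "\<forall>N w. large_for R N \<longrightarrow> inside N w \<longrightarrow>
      card {h\<in>H. slack h (real N + 1) w < R} \<le> card H \<longrightarrow>
      (\<exists>w'. (w, w') \<in> (step_rel N)\<^sup>* \<and> deep (max D D0) N w')"
    using reaches_deep_aux[OF D, of "max D D0" "card H"] by auto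
  show thesis
  proof (rule that[of R])
    fix N w assume "large_for R N" "inside N w"
    moreover have "card {h\<in>H. slack h (real N + 1) w < R} \<le> card H"
      using finite_H by (intro card_mono) auto
    ultimately obtain w' where "(w, w') \<in> (step_rel N)\<^sup>*" "deep (max D D0) N w'" using R by blast
    then show "\<exists>w'. (w, w') \<in> (step_rel N)\<^sup>* \<and> deep D0 N w'" by (auto simp: deep_def)
  qed
qed

section \<open>Paths between deep points\<close>

lemma deep_mono: "deep D N w \<Longrightarrow> D' \<le> D \<Longrightarrow> deep D' N w"
  by (force simp: deep_def)

text \<open>Induction on how the semigroup produces \<open>g\<close>. At depth \<open>D\<close>
  every single edge is available; for a sum, the extra depth \<open>L\<close> must also cover the
  slack lost on the way to the intermediate point.\<close>

lemma deep_translate: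
  assumes D: "\<And>h v. h \<in> H \<Longrightarrow> v \<in> vertices a \<Gamma> \<Longrightarrow> slack h 1 v \<le> D"
  shows "\<exists>L\<ge>0. \<forall>N w. deep (D + L) N w \<longrightarrow> (w, w + g) \<in> (step_rel N)\<^sup>*"
proof -
  have "g \<in> semigroup_gen ((\<lambda>e. dst a e - src e) ` set_mset \<Gamma>)"
    using generating by (simp add: Zn_generating_def)
  then show ?thesis
  proof induction
    case (base x)
    then obtain e where e: "e \<in># \<Gamma>" "x = dst a e - src e" by blast
    have "(w, w + x) \<in> (step_rel N)\<^sup>*" if "deep (D + 0) N w" for N w
    proof -
      have "(w, w + x) \<in> step_rel N" unfolding e(2)
      proof (rule step_relI[OF e(1)])
        fix h assume "h \<in> H"
        then show "slack h 1 (src e) \<le> slack h (real N + 1) w"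
          using D[OF _ edge_vertices(1)[OF e(1)], of h] that by (force simp: deep_def)
      qed
      then show ?thesis by blast
    qed
    then show ?case by (intro exI[of _ 0]) blast
  next
    case (add x y)
    then obtain L L' where L: "L \<ge> 0" "\<And>N w. deep (D + L) N w \<Longrightarrow> (w, w + x) \<in> (step_rel N)\<^sup>*"
      and L': "L' \<ge> 0" "\<And>N w. deep (D + L') N w \<Longrightarrow> (w, w + y) \<in> (step_rel N)\<^sup>*" by blast
    \<comment> \<open>Moving by \<open>x\<close> changes the slack of \<open>h\<close> by
      \<open>slack h 0 x\<close>, so \<open>B\<close> bounds the loss for all constraints at
      once.\<close>
    define B where "B = (\<Sum>h\<in>H. \<bar>slack h 0 x\<bar>)"
    have B: "\<bar>slack h 0 x\<bar> \<le> B" if "h \<in> H" for h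
      unfolding B_def using that finite_H by (intro member_le_sum) auto
    have "B \<ge> 0" unfolding B_def by (simp add: sum_nonneg)
    have "(w, w + (x + y)) \<in> (step_rel N)\<^sup>*" if dp: "deep (D + (L + L' + B)) N w" for N w
    proof -
      have "deep (D + L) N w" using dp by (rule deep_mono) (use L'(1) \<open>B \<ge> 0\<close> in simp)
      then have "(w, w + x) \<in> (step_rel N)\<^sup>*" by (rule L(2))
      moreover have "deep (D + L') N (w + x)" unfolding deep_def
      proof
        fix h assume h: "h \<in> H"
        have "slack h (real N + 1) (w + x) = slack h (real N + 1) w + slack h 0 x"
          using slack_add[of h "real N + 1" 0 w x] by simp
        with B[OF h] dp h L(1) show "D + L' \<le> slack h (real N + 1) (w + x)"
          by (fastforce simp: deep_def)
      qed
      then have "(w + x, w + x + y) \<in> (step_rel N)\<^sup>*" by (rule L'(2))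
      ultimately show ?thesis by (simp add: add.assoc)
    qed
    moreover have "L + L' + B \<ge> 0" using L(1) L'(1) \<open>B \<ge> 0\<close> by simp
    ultimately show ?case by blast
  qed
qed

text \<open>Walk along the lattice points obtained by rounding a fine subdivision of the segment from
  \<open>w\<close> to \<open>w'\<close>; consecutive ones differ by one of finitely many vectors.\<close>

lemma deep_connected:
  obtains D0 where "\<And>N w w'. deep D0 N w \<Longrightarrow> deep D0 N w' \<Longrightarrow> (w, w') \<in> (step_rel N)\<^sup>*"
proof -
  obtain D where D: "\<And>h v. h \<in> H \<Longrightarrow> v \<in> vertices a \<Gamma> \<Longrightarrow> slack h 1 v \<le> D"
    using slack_bound by blast
  define U where "U = {g :: int ^ 'n. \<forall>i. \<bar>g $ i\<bar> \<le> 1}"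
  have finU: "finite U" unfolding U_def by (rule finite_bounded_int_vec)
  obtain L where L: "\<And>g. L g \<ge> 0" "\<And>g N w. deep (D + L g) N w \<Longrightarrow> (w, w + g) \<in> (step_rel N)\<^sup>*"
    using deep_translate[OF D] by metis
  define L1 where "L1 = sum L U"
  have L1: "L g \<le> L1" if "g \<in> U" for g
    unfolding L1_def using that finU L(1) by (intro member_le_sum) auto
  \<comment> \<open>Rounding each coordinate down moves a point by norm at most
    \<open>CARD('n)\<close>, so \<open>B\<close> bounds the slack lost by rounding.\<close>
  define B where "B = (\<Sum>h\<in>H. norm (fst h) * real CARD('n))"
  have B: "norm (fst h) * real CARD('n) \<le> B" if "h \<in> H" for h
    unfolding B_def using that finite_H by (intro member_le_sum) auto
  show thesis
  proof (rule that[of "D + L1 + B"])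
    fix N w w' assume dp: "deep (D + L1 + B) N w" "deep (D + L1 + B) N w'"
    \<comment> \<open>\<open>T\<close> bounds every coordinate of the difference, so each of
      \<open>T\<close> equal pieces changes a coordinate, and hence its floor, by at most 1.
      \<open>Suc\<close> prevents division by zero when \<open>w = w'\<close>.\<close>
    define T where "T = Suc (nat (\<Sum>i\<in>UNIV. \<bar>w' $ i - w $ i\<bar>))"
    have T: "\<bar>real_of_int (w' $ i) - real_of_int (w $ i)\<bar> \<le> real T" for i
    proof -
      have "\<bar>w' $ i - w $ i\<bar> \<le> (\<Sum>i\<in>UNIV. \<bar>w' $ i - w $ i\<bar>)"
        by (rule member_le_sum) auto
      then have "\<bar>w' $ i - w $ i\<bar> \<le> int T" unfolding T_def by linarith
      then show ?thesis by linarith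
    qed
    have "T > 0" by (simp add: T_def)
    define x where "x k = to_real w + (real k / real T) *\<^sub>R (to_real w' - to_real w)" for k
    define p where "p k = (\<chi> i. \<lfloor>x k $ i\<rfloor>)" for k
    have p0: "p 0 = w" by (simp add: p_def x_def to_real_def vec_eq_iff)
    have pT: "p T = w'" using \<open>T > 0\<close> by (simp add: p_def x_def to_real_def vec_eq_iff)
    have pU: "p (Suc k) - p k \<in> U" for k
    proof -
      have "\<bar>\<lfloor>x (Suc k) $ i\<rfloor> - \<lfloor>x k $ i\<rfloor>\<bar> \<le> 1" for i
      proof -
        have "x (Suc k) $ i - x k $ i = (real_of_int (w' $ i) - real_of_int (w $ i)) / real T"
          by (simp add: x_def to_real_def diff_divide_distrib add_divide_distrib algebra_simps)
        then have "\<bar>x (Suc k) $ i - x k $ i\<bar> \<le> 1"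
          using T[of i] \<open>T > 0\<close> by (simp add: divide_le_eq)
        then show ?thesis by linarith
      qed
      then show ?thesis by (simp add: U_def p_def)
    qed
    have deep_p: "deep (D + L1) N (p k)" if "k \<le> T" for k unfolding deep_def
    proof
      fix h assume h: "h \<in> H"
      let ?t = "real k / real T" and ?r = "real N + 1"
      have t: "0 \<le> ?t" "?t \<le> 1" using that \<open>T > 0\<close> by auto
      have "norm (to_real (p k) - x k) \<le> (\<Sum>i\<in>UNIV. \<bar>(to_real (p k) - x k) $ i\<bar>)"
        by (rule norm_le_l1_cart)
      also have "\<dots> \<le> (\<Sum>i\<in>(UNIV :: 'n set). 1)"
      proof (rule sum_mono)
        fix i
        show "\<bar>(to_real (p k) - x k) $ i\<bar> \<le> 1"
          unfolding to_real_def p_def by simp linarith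
      qed
      also have "\<dots> = real CARD('n)" by simp
      finally have "norm (to_real (p k) - x k) \<le> real CARD('n)" .
      then have "norm (fst h) * norm (to_real (p k) - x k) \<le> norm (fst h) * real CARD('n)"
        by (rule mult_left_mono) simp
      then have "\<bar>fst h \<bullet> (to_real (p k) - x k)\<bar> \<le> B"
        using B[OF h] Cauchy_Schwarz_ineq2[of "fst h" "to_real (p k) - x k"] by linarith
      \<comment> \<open>Slack is affine, so points of the segment are as deep as its ends; the last
        term is the rounding error.\<close>
      moreover have "slack h ?r (p k) =
          (1 - ?t) * slack h ?r w + ?t * slack h ?r w' - fst h \<bullet> (to_real (p k) - x k)"
        unfolding slack_def x_def inner_diff_right inner_add_right inner_scaleR_right
        by (simp add: algebra_simps)
      moreover have "(1 - ?t) * (D + L1 + B) \<le> (1 - ?t) * slack h ?r w"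
        using dp(1) h t by (intro mult_left_mono) (auto simp: deep_def)
      moreover have "?t * (D + L1 + B) \<le> ?t * slack h ?r w'"
        using dp(2) h t by (intro mult_left_mono) (auto simp: deep_def)
      moreover have "(1 - ?t) * (D + L1 + B) + ?t * (D + L1 + B) = D + L1 + B"
        by (simp only: distrib_right[symmetric]) simp
      ultimately show "D + L1 \<le> slack h ?r (p k)" by linarith
    qed
    have "(p 0, p k) \<in> (step_rel N)\<^sup>*" if "k \<le> T" for k
      using that
    proof (induction k)
      case (Suc k)
      have "deep (D + L (p (Suc k) - p k)) N (p k)"
        by (rule deep_mono[OF deep_p]) (use Suc.prems L1[OF pU[of k]] in auto)
      then have "(p k, p k + (p (Suc k) - p k)) \<in> (step_rel N)\<^sup>*" by (rule L(2))
      with Suc show ?case by auto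
    qed simp
    from this[of T] show "(w, w') \<in> (step_rel N)\<^sup>*" by (simp add: p0 pT)
  qed
qed

section \<open>The Euler circuit of the union\<close>

lemma edge_rel_union_translates:
  assumes zs: "set zs = {z. \<forall>h\<in>H. 0 \<le> slack h (real N) z}"
  shows "edge_rel src (dst a) (union_translates \<Gamma> zs) = step_rel N"
proof (intro subset_antisym subsetI)
  fix p assume "p \<in> edge_rel src (dst a) (union_translates \<Gamma> zs)"
  then obtain z s l where z: "z \<in> set zs" and e: "(s, l) \<in># \<Gamma>" and p: "p = (s + z, s + z + a l)"
    unfolding edge_rel_def set_mset_union_translates by (auto simp: src_def dst_def)
  have "p = (s + z, (s + z) + (dst a (s, l) - src (s, l)))"
    by (simp add: p src_def dst_def)
  moreover have "\<forall>h\<in>H. 0 \<le> slack h (real N) ((s + z) - src (s, l))"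
    using z by (simp add: zs src_def)
  ultimately show "p \<in> step_rel N" using e unfolding step_rel_def by blast
next
  fix p assume "p \<in> step_rel N"
  then obtain w s l where p: "p = (w, w + (dst a (s, l) - src (s, l)))" and e: "(s, l) \<in># \<Gamma>"
    and z: "\<forall>h\<in>H. 0 \<le> slack h (real N) (w - src (s, l))" unfolding step_rel_def by auto
  have "w - s \<in> set zs" using z by (simp add: zs src_def)
  with e have "(s + (w - s), l) \<in># union_translates \<Gamma> zs"
    unfolding set_mset_union_translates by force
  then have "(src (w, l), dst a (w, l)) \<in> edge_rel src (dst a) (union_translates \<Gamma> zs)"
    unfolding edge_rel_def by force
  then show "p \<in> edge_rel src (dst a) (union_translates \<Gamma> zs)"
    by (simp add: p src_def dst_def)
qed

lemma Gamma_nonempty: "\<Gamma> \<noteq> {#}"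
proof
  assume "\<Gamma> = {#}"
  have "x \<notin> semigroup_gen {}" for x :: "int ^ 'n"
  proof
    assume "x \<in> semigroup_gen {}"
    then show False by induction auto
  qed
  with generating \<open>\<Gamma> = {#}\<close> show False by (auto simp: Zn_generating_def)
qed

text \<open>Both sources reach deep points, and deep points reach each other. Balance reverses the
  second path, so the union is connected and \<open>euler_circuit\<close> applies.\<close>

lemma eulerian_union_translates:
  assumes bal: "balanced src (dst a) \<Gamma>"
    and large: "\<And>R. \<exists>N\<ge>1. large_for R N"
    and fin: "\<And>N. N \<ge> 1 \<Longrightarrow> finite {z. \<forall>h\<in>H. 0 \<le> slack h (real N) z}"
  shows "\<exists>zs. eulerian_gg a (union_translates \<Gamma> zs)"
proof -
  obtain D0 where D0: "\<And>N w w'. deep D0 N w \<Longrightarrow> deep D0 N w' \<Longrightarrow> (w, w') \<in> (step_rel N)\<^sup>*"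
    using deep_connected by blast
  obtain R where R: "\<And>N w. large_for R N \<Longrightarrow> inside N w \<Longrightarrow>
      \<exists>w'. (w, w') \<in> (step_rel N)\<^sup>* \<and> deep D0 N w'"
    using reaches_deep by blast
  obtain N where N: "N \<ge> 1" "large_for R N" using large by blast
  obtain zs where zs: "set zs = {z. \<forall>h\<in>H. 0 \<le> slack h (real N) z}"
    using finite_list[OF fin[OF N(1)]] by blast
  let ?E = "union_translates \<Gamma> zs"
  have rel: "edge_rel src (dst a) ?E = step_rel N" by (rule edge_rel_union_translates[OF zs])
  have balE: "balanced src (dst a) ?E" by (rule balanced_union_translates[OF bal])
  have inside_src: "inside N (src e)" if "e \<in># ?E" for e
  proof -
    from that obtain z s l where z: "z \<in> set zs" and sl: "(s, l) \<in># \<Gamma>" and e: "e = (s + z, l)"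
      unfolding set_mset_union_translates by auto
    show ?thesis unfolding inside_def
    proof
      fix h assume h: "h \<in> H"
      have "slack h (real N + 1) (z + s) = slack h (real N) z + slack h 1 s" by (rule slack_add)
      moreover have "0 \<le> slack h (real N) z" using z h by (simp add: zs)
      moreover have "0 \<le> slack h 1 s"
        using slack_nonneg[OF h edge_vertices(1)[OF sl]] by (simp add: src_def)
      ultimately show "0 \<le> slack h (real N + 1) (src e)" by (simp add: e src_def add.commute)
    qed
  qed
  have "?E \<noteq> {#}"
  proof -
    obtain e where e: "e \<in># \<Gamma>" using Gamma_nonempty by auto
    \<comment> \<open>The \<open>N\<close>-fold multiple of a vertex lies in the
      \<open>N\<close>-fold dilate, so at least one translate occurs.\<close>
    define z where "z = (\<chi> i. int N * src e $ i)"
    have "to_real z = real N *\<^sub>R to_real (src e)" by (simp add: z_def to_real_def vec_eq_iff)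
    then have "slack h (real N) z = real N * slack h 1 (src e)" for h
      by (simp add: slack_def algebra_simps)
    then have "z \<in> set zs" using slack_nonneg[OF _ edge_vertices(1)[OF e]] by (simp add: zs)
    with e have "set_mset ?E \<noteq> {}" unfolding set_mset_union_translates by blast
    then show ?thesis by simp
  qed
  moreover have "(src e, src f) \<in> (edge_rel src (dst a) ?E)\<^sup>*" if ef: "e \<in># ?E" "f \<in># ?E" for e f
  proof -
    obtain w where w: "(src e, w) \<in> (step_rel N)\<^sup>*" "deep D0 N w"
      using R[OF N(2) inside_src[OF ef(1)]] by blast
    obtain w' where w': "(src f, w') \<in> (step_rel N)\<^sup>*" "deep D0 N w'"
      using R[OF N(2) inside_src[OF ef(2)]] by blast
    have "(w', src f) \<in> (step_rel N)\<^sup>*" using balanced_reach_sym[OF balE] w'(1) by (simp add: rel)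
    with w(1) D0[OF w(2) w'(2)] show ?thesis unfolding rel by (meson rtrancl_trans)
  qed
  ultimately obtain es u where es: "es \<noteq> []" "mset es = ?E" "walk src (dst a) u es u"
    using euler_circuit[OF balE] by blast
  have "eulerian_gg a ?E" unfolding eulerian_gg_def
    using es walk_consecutive[OF es(3)] walk_ends[OF es(3,1)] by metis
  then show ?thesis by blast
qed

end

section \<open>Facial structure of the convex hull\<close>

lemma polytope_halfspaces:
  fixes C :: "'a :: euclidean_space set"
  assumes "polytope C"
  obtains H :: "('a \<times> real) set" where "finite H" "\<And>h. h \<in> H \<Longrightarrow> fst h \<noteq> 0"
    "C = {x. \<forall>h\<in>H. fst h \<bullet> x \<le> snd h}"
proof -
  obtain F where F: "finite F" "C = \<Inter>F" "\<forall>P\<in>F. \<exists>u b. u \<noteq> 0 \<and> P = {x. u \<bullet> x \<le> b}"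
    using polytope_imp_polyhedron[OF assms] unfolding polyhedron_def by blast
  then obtain u b where ub: "\<And>P. P \<in> F \<Longrightarrow> u P \<noteq> 0 \<and> P = {x. u P \<bullet> x \<le> b P}" by metis
  show thesis
  proof (rule that[of "(\<lambda>P. (u P, b P)) ` F"])
    show "C = {x. \<forall>h\<in>(\<lambda>P. (u P, b P)) ` F. fst h \<bullet> x \<le> snd h}"
      unfolding F(2) using ub by auto
  qed (use F ub in auto)
qed

text \<open>Orthogonality to \<open>u\<close> is preserved by sums, hence holds for all lattice
  points and in particular for the standard basis. It serves to show that no bounding hyperplane
  contains the whole hull.\<close>

lemma lattice_hyperplane_trivial:
  assumes "semigroup_gen S = (UNIV :: (int ^ 'n) set)" and "\<And>g. g \<in> S \<Longrightarrow> u \<bullet> to_real g = 0"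
  shows "u = 0"
proof -
  have "u \<bullet> to_real g = 0" for g
  proof -
    have "g \<in> semigroup_gen S" by (simp add: assms(1))
    then show ?thesis by induction (auto simp: assms(2) to_real_add inner_add_right)
  qed
  moreover have "to_real (axis i 1) = axis i 1" for i :: 'n
    by (simp add: to_real_def axis_def vec_eq_iff)
  ultimately have "u \<bullet> axis i 1 = 0" for i by metis
  then show ?thesis by (simp add: inner_axis vec_eq_iff)
qed

theorem mainTheorem5:
  fixes K :: nat and y :: "nat \<Rightarrow> 'y" and a :: "nat \<Rightarrow> int ^ 'n" and \<Gamma> :: "'n ggraph"
  assumes "is_ggraph K a \<Gamma>"
    and "symmetric_gg a \<Gamma>"
    and "face_accessible a \<Gamma>"
    and "Zn_generating a \<Gamma>"
  shows "\<exists>zs :: (int ^ 'n) list. eulerian_gg a (union_translates \<Gamma> zs)"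
proof -
  define C where "C = convex hull (to_real ` vertices a \<Gamma>)"
  have "finite (vertices a \<Gamma>)" by (simp add: vertices_def)
  then have "polytope C" unfolding C_def polytope_def by blast
  then have C: "compact C" "convex C" by (simp_all add: polytope_imp_compact polytope_imp_convex)
  obtain H :: "((real ^ 'n) \<times> real) set" where H: "finite H" "\<And>h. h \<in> H \<Longrightarrow> fst h \<noteq> 0"
    and CH: "C = {x. \<forall>h\<in>H. fst h \<bullet> x \<le> snd h}"
    using polytope_halfspaces[OF \<open>polytope C\<close>] by blast
  have vC: "to_real v \<in> C" if "v \<in> vertices a \<Gamma>" for v
    using that unfolding C_def by (simp add: hull_inc)
  interpret slack_system a \<Gamma> H
  proof
    show "0 \<le> slack h 1 v" if "h \<in> H" "v \<in> vertices a \<Gamma>" for h v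
      using vC[OF that(2)] that(1) by (auto simp: CH slack_def)
  qed (use H assms(4) in auto)
  have slack_scale: "slack h r x = r * (snd h - fst h \<bullet> ((1 / r) *\<^sub>R to_real x))"
    if "r > 0" for h r and x :: "int ^ 'n"
    using that by (simp add: slack_def algebra_simps)
  have scale_in_C: "(1 / r) *\<^sub>R to_real x \<in> C" if "r > 0" "\<forall>h\<in>H. 0 \<le> slack h r x" for r x
    using that by (auto simp: CH slack_scale zero_le_mult_iff)
  show ?thesis
  proof (rule eulerian_union_translates)
    show "balanced src (dst a) \<Gamma>" using assms(2) by (simp add: symmetric_gg_def balanced_def)
  next
    fix N :: nat assume N: "N \<ge> 1"
    obtain M where M: "\<And>x. x \<in> C \<Longrightarrow> norm x \<le> M"
      using compact_imp_bounded[OF C(1)] bounded_iff by blast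
    have "{z. \<forall>h\<in>H. 0 \<le> slack h (real N) z} \<subseteq> {z. \<forall>i. \<bar>z $ i\<bar> \<le> \<lceil>real N * M\<rceil>}"
    proof (intro subsetI CollectI allI)
      fix z i assume "z \<in> {z. \<forall>h\<in>H. 0 \<le> slack h (real N) z}"
      then have "norm ((1 / real N) *\<^sub>R to_real z) \<le> M" using N by (intro M scale_in_C) auto
      then have "norm (to_real z) \<le> real N * M" using N by (simp add: field_simps)
      moreover have "\<bar>to_real z $ i\<bar> \<le> norm (to_real z)" by (rule component_le_norm_cart)
      ultimately have "\<bar>real_of_int (z $ i)\<bar> \<le> real N * M" by (simp add: to_real_def)
      then show "\<bar>z $ i\<bar> \<le> \<lceil>real N * M\<rceil>" by linarith
    qed
    then show "finite {z. \<forall>h\<in>H. 0 \<le> slack h (real N) z}"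
      by (rule finite_subset[OF _ finite_bounded_int_vec])
  next
    fix R :: real
    \<comment> \<open>A family \<open>J\<close> that is not accessible cuts out the empty face of
      \<open>C\<close>. By compactness its total slack is bounded below by a positive constant on
      \<open>C\<close>, and this bound grows linearly under dilation.\<close>
    have ev: "\<forall>\<^sub>F N in sequentially. \<forall>w. inside N w \<longrightarrow> (\<exists>h\<in>J. R \<le> slack h (real N + 1) w)"
      if J: "J \<subseteq> H" "J \<noteq> {}" and nacc: "\<not> accessible J" for J
    proof -
      have finJ: "finite J" using J(1) H(1) finite_subset by blast
      define F where "F = C \<inter> (\<Inter>h\<in>J. {x. fst h \<bullet> x = snd h})"
      have "(C \<inter> {x. fst h \<bullet> x = snd h}) face_of C" if "h \<in> J" for h
        using that J(1) C(2) by (intro face_of_Int_supporting_hyperplane_le) (auto simp: CH)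
      then have "\<Inter> ((\<lambda>h. C \<inter> {x. fst h \<bullet> x = snd h}) ` J) face_of C"
        using J(2) by (intro face_of_Inter) auto
      moreover have "\<Inter> ((\<lambda>h. C \<inter> {x. fst h \<bullet> x = snd h}) ` J) = F"
        unfolding F_def using J(2) by auto
      ultimately have "F face_of C" by simp
      \<comment> \<open>Otherwise all vertices lie on one hyperplane and its nonzero normal is
        orthogonal to every edge step.\<close>
      have "F \<noteq> C"
      proof
        assume "F = C"
        obtain h where h: "h \<in> J" using J(2) by blast
        have "fst h \<bullet> to_real v = snd h" if "v \<in> vertices a \<Gamma>" for v
          using vC[OF that] h \<open>F = C\<close> unfolding F_def by blast
        then have "fst h \<bullet> to_real g = 0" if "g \<in> (\<lambda>e. dst a e - src e) ` set_mset \<Gamma>" for g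
          using that edge_vertices by (auto simp: to_real_diff inner_diff_right)
        then have "fst h = 0"
          using assms(4) unfolding Zn_generating_def by (rule lattice_hyperplane_trivial[rotated])
        with H(2) h J(1) show False by blast
      qed
      \<comment> \<open>For a nonempty \<open>F\<close>, face-accessibility gives an edge leaving
        it; its target has positive slack for some member of \<open>J\<close>, making
        \<open>J\<close> accessible.\<close>
      have "F = {}"
      proof (rule ccontr)
        assume "F \<noteq> {}"
        with \<open>F face_of C\<close> \<open>F \<noteq> C\<close> obtain e
          where e: "e \<in># \<Gamma>" "to_real (src e) \<in> F" "to_real (dst a e) \<notin> F"
          using assms(3) unfolding face_accessible_def Let_def C_def[symmetric] by blast
        then obtain h where h: "h \<in> J" "fst h \<bullet> to_real (dst a e) \<noteq> snd h"
          using vC[OF edge_vertices(2)[OF e(1)]] unfolding F_def by blast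
        moreover have "0 \<le> slack h 1 (dst a e)"
          using h(1) J(1) e(1) by (intro slack_nonneg edge_vertices(2)) auto
        ultimately have "0 < slack h 1 (dst a e)" by (simp add: slack_def)
        moreover have "\<forall>h\<in>J. slack h 1 (src e) = 0" using e(2) by (simp add: F_def slack_def)
        ultimately have "accessible J" unfolding accessible_def using e(1) h(1) by blast
        with nacc show False by blast
      qed
      define \<phi> where "\<phi> x = (\<Sum>h\<in>J. snd h - fst h \<bullet> x)" for x
      have "C \<noteq> {}" using Gamma_nonempty vC edge_vertices(1) by blast
      moreover have "continuous_on C \<phi>" unfolding \<phi>_def by (intro continuous_intros)
      ultimately obtain x0 where x0: "x0 \<in> C" "\<And>x. x \<in> C \<Longrightarrow> \<phi> x0 \<le> \<phi> x"
        using continuous_attains_inf[OF C(1)] by blast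
      have nn: "0 \<le> snd h - fst h \<bullet> x0" if "h \<in> J" for h using x0(1) that J(1) by (auto simp: CH)
      have "\<phi> x0 > 0"
      proof (rule ccontr)
        assume "\<not> ?thesis"
        then have "\<phi> x0 = 0" using sum_nonneg[of J "\<lambda>h. snd h - fst h \<bullet> x0"] nn unfolding \<phi>_def by force
        then have "\<forall>h\<in>J. snd h - fst h \<bullet> x0 = 0"
          unfolding \<phi>_def
          using sum_nonneg_eq_0_iff[where f = "\<lambda>h. snd h - fst h \<bullet> x0", OF finJ] nn by blast
        then have "x0 \<in> F" using x0(1) by (auto simp: F_def)
        with \<open>F = {}\<close> show False by blast
      qed
      \<comment> \<open>Chosen so that the total slack, at least \<open>(N + 1) * \<phi> x0\<close>,
        exceeds \<open>card J * R\<close>; then some member of \<open>J\<close> has slack at least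
        \<open>R\<close>.\<close>
      obtain N0 where N0: "real (card J) * R / \<phi> x0 \<le> real N0" using real_arch_simple by blast
      have "\<exists>h\<in>J. R \<le> slack h (real N + 1) w" if "N \<ge> N0" "inside N w" for N w
      proof (rule ccontr)
        assume "\<not> ?thesis"
        then have "(\<Sum>h\<in>J. slack h (real N + 1) w) < of_nat (card J) * R"
          using finJ J by (intro sum_bounded_above_strict) (auto simp: card_gt_0_iff not_le)
        also have "\<dots> \<le> real N0 * \<phi> x0" using N0 \<open>\<phi> x0 > 0\<close> by (simp add: field_simps)
        also have "\<dots> \<le> (real N + 1) * \<phi> x0"
          using that(1) \<open>\<phi> x0 > 0\<close> by (intro mult_right_mono) auto
        also have "\<dots> \<le> (real N + 1) * \<phi> ((1 / (real N + 1)) *\<^sub>R to_real w)"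
          using that(2) by (intro mult_left_mono x0(2) scale_in_C) (auto simp: inside_def)
        also have "\<dots> = (\<Sum>h\<in>J. slack h (real N + 1) w)"
          unfolding \<phi>_def sum_distrib_left by (intro sum.cong refl slack_scale[symmetric]) simp
        finally show False by simp
      qed
      then show ?thesis unfolding eventually_sequentially by blast
    qed
    \<comment> \<open>\<open>H\<close> has only finitely many subsets, so one threshold serves all
      of them.\<close>
    have "\<forall>\<^sub>F N in sequentially. \<forall>J\<in>{J. J \<subseteq> H \<and> J \<noteq> {} \<and> \<not> accessible J}.
        \<forall>w. inside N w \<longrightarrow> (\<exists>h\<in>J. R \<le> slack h (real N + 1) w)"
      using ev H(1) by (intro eventually_ball_finite) auto
    then have "\<forall>\<^sub>F N in sequentially. large_for R N"
      by (rule eventually_mono) (simp add: large_for_def)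
    with eventually_ge_at_top[of 1] have "\<forall>\<^sub>F N in sequentially. N \<ge> 1 \<and> large_for R N"
      by (rule eventually_conj)
    then show "\<exists>N\<ge>1. large_for R N" using eventually_happens by fastforce
  qed
qed

end
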